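(* Let $E(n)\in\mathcal{E}(n)$ be an expression of degree $d^0(E(n))=r$, with $E(n)\not\equiv 0$, and let $n_E\in\mathbb{N}$ be such that $E(n)$ is well defined for all $n\in\mathbb{N}$ with $n\ge n_E$. Consider the series $\sum_{n\ge n_E}E(n)$. Then: (A) if $r<-1$, the series is absolutely convergent; (B) if $r\ge -1$, the series is divergent.
   Context: The family $\mathcal{E}(n)$ consists of real-valued expressions $E(n)$ in a positive integer variable $n$, each well defined for all integers $n\ge n_E$ for some $n_E\in\mathbb{N}$. The family is defined recursively, together with the degree $d^0(E(n))\in\mathbb{R}$ and the leading coefficient $c(E(n))\in\mathbb{R}$ of each of its expressions, as follows. 1. Every nonzero real constant $a$ belongs to $\mathcal{E}(n)$, with $d^0(a)=0$ and $c(a)=a$. 2. The expression $n$ belongs to $\mathcal{E}(n)$, with $d^0(n)=1$ and $c(n)=1$. 3. Suppose $E_1(n),E_2(n)\in\mathcal{E}(n)$ with $d^0(E_1(n))=r_1$, $d^0(E_2(n))=r_2$, $c(E_1(n))=a_1$, $c(E_2(n))=a_2$. Then: (a) $E_1(n)E_2(n)\in\mathcal{E}(n)$, with degree $r_1+r_2$ and leading coefficient $a_1a_2$. (b) If $E_2(n)\ne 0$ for all integers $n\ge n_{E_2}$ (some $n_{E_2}\in\mathbb{N}$), then $E_1(n)/E_2(n)\in\mathcal{E}(n)$, with degree $r_1-r_2$ and leading coefficient $a_1/a_2$. (c) If $\alpha$ is a real constant and the real power $(E_1(n))^\alpha$ is well defined for all integers $n\ge n_{E_1}$ (some $n_{E_1}\in\mathbb{N}$),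 then $(E_1(n))^\alpha\in\mathcal{E}(n)$, with degree $r_1\alpha$ and leading coefficient $a_1^\alpha$. (Real powers of negative numbers are understood in the usual real sense: they are defined when $\alpha$ is rational with odd denominator in lowest terms, via real odd roots.) (d) If $r_1\ne r_2$, then $E_1(n)\pm E_2(n)\in\mathcal{E}(n)$, with degree $\max(r_1,r_2)$ and leading coefficient $a_1$ if $r_1>r_2$, and $\pm a_2$ (same sign as in $E_1\pm E_2$) if $r_2>r_1$. (e) If $r_1=r_2$ and $a_1+a_2\ne 0$, then $E_1(n)+E_2(n)\in\mathcal{E}(n)$, with degree $r_1$ and leading coefficient $a_1+a_2$. (f) If $r_1=r_2$ and $a_1-a_2\ne 0$, then $E_1(n)-E_2(n)\in\mathcal{E}(n)$, with degree $r_1$ and leading coefficient $a_1-a_2$. 4. $\mathcal{E}(n)$ consists exactly of the expressions obtained from 1 and 2 by applying step 3 a finite number of times. *)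

theory Defs
  imports Complex_Main
begin

text \<open>
  Real powers in the usual real sense. A negative base admits exactly the rational exponents
  whose denominator in lowest terms is odd; \<open>0\<close> admits exactly the positive exponents.
  Since \<^const>\<open>quotient_of\<close> returns the fraction in lowest terms with positive denominator,
  \<open>lowest_terms\<close> is meaningful on rational reals only.
\<close>

definition lowest_terms :: "real \<Rightarrow> int \<times> int" where
  "lowest_terms \<alpha> = quotient_of (THE s. real_of_rat s = \<alpha>)"

definition rpow_defined :: "real \<Rightarrow> real \<Rightarrow> bool" where
  "rpow_defined x \<alpha> \<longleftrightarrow>
     x > 0 \<or> (x = 0 \<and> \<alpha> > 0) \<or> (x < 0 \<and> \<alpha> \<in> \<rat> \<and> odd (snd (lowest_terms \<alpha>)))"

definition rpow :: "real \<Rightarrow> real \<Rightarrow> real" where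
  "rpow x \<alpha> =
     (if x > 0 then x powr \<alpha>
      else if x = 0 then 0
      else (case lowest_terms \<alpha> of (p, q) \<Rightarrow> root (nat q) x powi p))"

datatype expr =
    Const real
  | Var
  | Mult expr expr
  | Divide expr expr
  | Pow expr real
  | Add expr expr
  | Sub expr expr

primrec expr_val :: "expr \<Rightarrow> nat \<Rightarrow> real" where
  "expr_val (Const a) n = a"
| "expr_val Var n = real n"
| "expr_val (Mult E1 E2) n = expr_val E1 n * expr_val E2 n"
| "expr_val (Divide E1 E2) n = expr_val E1 n / expr_val E2 n"
| "expr_val (Pow E \<alpha>) n = rpow (expr_val E n) \<alpha>"
| "expr_val (Add E1 E2) n = expr_val E1 n + expr_val E2 n"
| "expr_val (Sub E1 E2) n = expr_val E1 n - expr_val E2 n"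

text \<open>The value of \<open>expr_val E n\<close> is meaningful only where \<open>defined_at E n\<close> holds.\<close>

primrec defined_at :: "expr \<Rightarrow> nat \<Rightarrow> bool" where
  "defined_at (Const a) n \<longleftrightarrow> True"
| "defined_at Var n \<longleftrightarrow> True"
| "defined_at (Mult E1 E2) n \<longleftrightarrow> defined_at E1 n \<and> defined_at E2 n"
| "defined_at (Divide E1 E2) n \<longleftrightarrow> defined_at E1 n \<and> defined_at E2 n \<and> expr_val E2 n \<noteq> 0"
| "defined_at (Pow E \<alpha>) n \<longleftrightarrow> defined_at E n \<and> rpow_defined (expr_val E n) \<alpha>"
| "defined_at (Add E1 E2) n \<longleftrightarrow> defined_at E1 n \<and> defined_at E2 n"
| "defined_at (Sub E1 E2) n \<longleftrightarrow> defined_at E1 n \<and> defined_at E2 n"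

text \<open>
  The family, with degree and leading coefficient generated simultaneously:
  \<open>in_family E r a\<close> means that \<open>E\<close> belongs to the family and has degree \<open>r\<close> and
  leading coefficient \<open>a\<close>.
\<close>

inductive in_family :: "expr \<Rightarrow> real \<Rightarrow> real \<Rightarrow> bool" where
  const: "a \<noteq> 0 \<Longrightarrow> in_family (Const a) 0 a"
| var: "in_family Var 1 1"
| mult: "in_family E1 r1 a1 \<Longrightarrow> in_family E2 r2 a2 \<Longrightarrow>
    in_family (Mult E1 E2) (r1 + r2) (a1 * a2)"
| divide: "in_family E1 r1 a1 \<Longrightarrow> in_family E2 r2 a2 \<Longrightarrow>
    \<exists>N. \<forall>n\<ge>N. defined_at E2 n \<and> expr_val E2 n \<noteq> 0 \<Longrightarrow>
    in_family (Divide E1 E2) (r1 - r2) (a1 / a2)"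
| pow: "in_family E1 r1 a1 \<Longrightarrow>
    \<exists>N. \<forall>n\<ge>N. defined_at E1 n \<and> rpow_defined (expr_val E1 n) \<alpha> \<Longrightarrow>
    in_family (Pow E1 \<alpha>) (r1 * \<alpha>) (rpow a1 \<alpha>)"
| add_neq: "in_family E1 r1 a1 \<Longrightarrow> in_family E2 r2 a2 \<Longrightarrow> r1 \<noteq> r2 \<Longrightarrow>
    in_family (Add E1 E2) (max r1 r2) (if r1 > r2 then a1 else a2)"
| sub_neq: "in_family E1 r1 a1 \<Longrightarrow> in_family E2 r2 a2 \<Longrightarrow> r1 \<noteq> r2 \<Longrightarrow>
    in_family (Sub E1 E2) (max r1 r2) (if r1 > r2 then a1 else - a2)"
| add_eq: "in_family E1 r a1 \<Longrightarrow> in_family E2 r a2 \<Longrightarrow> a1 + a2 \<noteq> 0 \<Longrightarrow>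
    in_family (Add E1 E2) r (a1 + a2)"
| sub_eq: "in_family E1 r a1 \<Longrightarrow> in_family E2 r a2 \<Longrightarrow> a1 - a2 \<noteq> 0 \<Longrightarrow>
    in_family (Sub E1 E2) r (a1 - a2)"

end

theory Submission
  imports Defs "HOL-Analysis.Summation_Tests"
begin

text \<open>
  An expression of degree \<open>r\<close> and leading coefficient \<open>c\<close> behaves like \<open>c n\<^sup>r\<close>: the
  coefficient \<open>c\<close> is nonzero and \<open>E(n) / n\<^sup>r\<close> tends to \<open>c\<close>. This follows by induction over
  the construction of the family (\<open>in_family_leading_term\<close>). Each arithmetic rule corresponds
  to a limit law, the side conditions on degrees and coefficients being just what prevents
  the leading terms from cancelling. The only rule that needs an argument of its own is the
  real power of an expression with negative leading coefficient: there the values are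
  eventually negative, so the exponent must be rational with odd denominator, and on negative
  bases such a power is, up to a sign depending only on the exponent, the ordinary power of
  the absolute value (\<open>rpow_neg\<close>).

  Since \<open>c \<noteq> 0\<close>, the quotient \<open>E(n) / c\<close> is positive and comparable to \<open>n\<^sup>r\<close> in both directions
  for large \<open>n\<close>, so the series converges, absolutely or not, exactly if \<open>\<Sum> n\<^sup>r\<close> does,
  that is, if \<open>r < -1\<close>.
\<close>

section \<open>Leading terms and the limit laws\<close>

definition has_leading_term :: "(nat \<Rightarrow> real) \<Rightarrow> real \<Rightarrow> real \<Rightarrow> bool" where
  "has_leading_term f r a \<longleftrightarrow> (\<lambda>n. f n / real n powr r) \<longlonglongrightarrow> a"

lemma has_leading_term_mult:
  assumes "has_leading_term f r a" "has_leading_term g s b"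
  shows "has_leading_term (\<lambda>n. f n * g n) (r + s) (a * b)"
  using tendsto_mult[OF assms[unfolded has_leading_term_def]]
  by (simp add: has_leading_term_def powr_add)

lemma has_leading_term_divide:
  assumes "has_leading_term f r a" "has_leading_term g s b" "b \<noteq> 0"
  shows "has_leading_term (\<lambda>n. f n / g n) (r - s) (a / b)"
  using tendsto_divide[OF assms[unfolded has_leading_term_def]]
  by (simp add: has_leading_term_def powr_diff mult.commute)

lemma has_leading_term_add:
  assumes "has_leading_term f r a" "has_leading_term g r b"
  shows "has_leading_term (\<lambda>n. f n + g n) r (a + b)"
  using tendsto_add[OF assms[unfolded has_leading_term_def]]
  by (simp add: has_leading_term_def add_divide_distrib)

lemma has_leading_term_uminus:
  assumes "has_leading_term f r a"
  shows "has_leading_term (\<lambda>n. - f n) r (- a)"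
  using tendsto_minus[OF assms[unfolded has_leading_term_def]]
  by (simp add: has_leading_term_def)

lemma has_leading_term_diff:
  assumes "has_leading_term f r a" "has_leading_term g r b"
  shows "has_leading_term (\<lambda>n. f n - g n) r (a - b)"
  using has_leading_term_add[OF assms(1) has_leading_term_uminus[OF assms(2)]] by simp

text \<open>
  Letting the coefficient be \<open>0\<close> turns the sum rules for different degrees into instances of the
  sum rules for equal degrees: the term of lower degree is regarded as one of the higher degree.
\<close>
lemma has_leading_term_raise_degree:
  assumes "has_leading_term f r a" "r < s"
  shows "has_leading_term f s 0"
proof -
  have "(\<lambda>n. real n powr (r - s)) \<longlonglongrightarrow> 0"
    using \<open>r < s\<close> by (intro tendsto_neg_powr filterlim_real_sequentially) simp
  from tendsto_mult[OF assms(1)[unfolded has_leading_term_def] this]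
  have "(\<lambda>n. f n / real n powr r * real n powr (r - s)) \<longlonglongrightarrow> 0" by simp
  moreover have "f n / real n powr r * real n powr (r - s) = f n / real n powr s" for n
    by (simp add: powr_diff)
  ultimately show ?thesis by (simp add: has_leading_term_def)
qed

lemma has_leading_term_add_neq:
  assumes "has_leading_term f r a" "has_leading_term g s b" "r \<noteq> s"
  shows "has_leading_term (\<lambda>n. f n + g n) (max r s) (if r > s then a else b)"
proof (cases "r > s")
  case True
  then show ?thesis
    using has_leading_term_add[OF assms(1) has_leading_term_raise_degree[OF assms(2) True]]
    by (simp add: max_def)
next
  case False
  then have "r < s" using \<open>r \<noteq> s\<close> by simp
  then show ?thesis
    using has_leading_term_add[OF has_leading_term_raise_degree[OF assms(1)] assms(2)]
    by (simp add: max_def)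
qed

section \<open>Real powers\<close>

lemma snd_lowest_terms_pos: "snd (lowest_terms \<alpha>) > 0"
  by (simp add: lowest_terms_def quotient_of_denom_pos')

lemma lowest_terms_rat:
  assumes "\<alpha> \<in> \<rat>"
  shows "\<alpha> = real_of_int (fst (lowest_terms \<alpha>)) / real_of_int (snd (lowest_terms \<alpha>))"
proof -
  obtain s where s: "\<alpha> = real_of_rat s" using assms by (auto elim: Rats_cases)
  have "(THE t. real_of_rat t = \<alpha>) = s" by (rule the_equality) (simp_all add: s)
  then have "lowest_terms \<alpha> = quotient_of s" by (simp add: lowest_terms_def)
  moreover have "s = of_int (fst (quotient_of s)) / of_int (snd (quotient_of s))"
    by (rule quotient_of_div) simp
  then have "\<alpha> = real_of_rat (of_int (fst (quotient_of s)) / of_int (snd (quotient_of s)))"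
    using s by simp
  ultimately show ?thesis by (simp add: of_rat_divide)
qed

lemma rpow_neg:
  assumes "x < 0" "\<alpha> \<in> \<rat>" "odd (snd (lowest_terms \<alpha>))"
  shows "rpow x \<alpha> = (-1) powi fst (lowest_terms \<alpha>) * \<bar>x\<bar> powr \<alpha>"
proof -
  obtain p q where pq: "lowest_terms \<alpha> = (p, q)" by fastforce
  have q: "q > 0" "odd q" using snd_lowest_terms_pos[of \<alpha>] assms(3) pq by auto
  have \<alpha>: "\<alpha> = real_of_int p / real_of_int q" using lowest_terms_rat[OF assms(2)] pq by simp
  have "root (nat q) \<bar>x\<bar> = \<bar>x\<bar> powr (1 / real_of_int q)"
    using q \<open>x < 0\<close> by (simp add: root_powr_inverse field_simps)
  then have "root (nat q) \<bar>x\<bar> powi p = \<bar>x\<bar> powr \<alpha>"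
    using \<open>x < 0\<close> by (simp add: \<alpha> powr_powr flip: powr_real_of_int')
  moreover have "root (nat q) x = - 1 * root (nat q) \<bar>x\<bar>"
    using \<open>x < 0\<close> by (simp add: real_root_minus)
  then have "root (nat q) x powi p = (-1) powi p * root (nat q) \<bar>x\<bar> powi p"
    by (simp only: power_int_mult_distrib)
  ultimately show ?thesis using \<open>x < 0\<close> pq by (simp add: rpow_def)
qed

lemma rpow_nonzero: "x \<noteq> 0 \<Longrightarrow> rpow x \<alpha> \<noteq> 0"
  using snd_lowest_terms_pos[of \<alpha>]
  by (auto simp: rpow_def split: prod.splits)

text \<open>
  Both signs of \<open>a\<close> reduce to one computation: near \<open>a\<close> the power is \<open>\<sigma> \<bar>x\<bar>\<^sup>\<alpha>\<close> with a constant
  \<open>\<sigma>\<close>, and \<open>\<bar>x\<bar>\<^sup>\<alpha>\<close> is multiplicative and continuous away from \<open>0\<close>.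
\<close>
lemma has_leading_term_rpow:
  assumes f: "has_leading_term f r a" and "a \<noteq> 0"
    and def: "eventually (\<lambda>n. rpow_defined (f n) \<alpha>) sequentially"
  shows "has_leading_term (\<lambda>n. rpow (f n) \<alpha>) (r * \<alpha>) (rpow a \<alpha>)"
proof -
  have lim: "(\<lambda>n. f n / real n powr r) \<longlonglongrightarrow> a" using f by (simp add: has_leading_term_def)
  have pos: "eventually (\<lambda>n::nat. n > 0) sequentially" by (rule eventually_gt_at_top)
  obtain \<sigma> where \<sigma>: "rpow a \<alpha> = \<sigma> * \<bar>a\<bar> powr \<alpha>"
    and ev: "eventually (\<lambda>n. rpow (f n) \<alpha> = \<sigma> * \<bar>f n\<bar> powr \<alpha>) sequentially"
  proof (cases "a > 0")
    case True
    have "eventually (\<lambda>n. f n / real n powr r > 0) sequentially"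
      using order_tendstoD(1)[OF lim True] .
    then have "eventually (\<lambda>n. rpow (f n) \<alpha> = 1 * \<bar>f n\<bar> powr \<alpha>) sequentially"
      using pos by eventually_elim (simp add: rpow_def zero_less_divide_iff)
    moreover have "rpow a \<alpha> = 1 * \<bar>a\<bar> powr \<alpha>" using True by (simp add: rpow_def)
    ultimately show ?thesis using that by blast
  next
    case False
    then have "a < 0" using \<open>a \<noteq> 0\<close> by simp
    have "eventually (\<lambda>n. f n / real n powr r < 0) sequentially"
      using order_tendstoD(2)[OF lim \<open>a < 0\<close>] .
    then have neg: "eventually (\<lambda>n. f n < 0) sequentially"
      using pos by eventually_elim (simp add: divide_less_0_iff)
    then have "eventually (\<lambda>n. f n < 0 \<and> rpow_defined (f n) \<alpha>) sequentially"
      using def by eventually_elim simp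
    then obtain m where "f m < 0" "rpow_defined (f m) \<alpha>"
      using eventually_happens'[OF sequentially_bot] by blast
    then have \<alpha>: "\<alpha> \<in> \<rat>" "odd (snd (lowest_terms \<alpha>))" by (auto simp: rpow_defined_def)
    have "eventually (\<lambda>n. rpow (f n) \<alpha> = (-1) powi fst (lowest_terms \<alpha>) * \<bar>f n\<bar> powr \<alpha>) sequentially"
      using neg by eventually_elim (rule rpow_neg[OF _ \<alpha>])
    then show ?thesis using that rpow_neg[OF \<open>a < 0\<close> \<alpha>] by blast
  qed
  have "(\<lambda>n. \<sigma> * \<bar>f n / real n powr r\<bar> powr \<alpha>) \<longlonglongrightarrow> \<sigma> * \<bar>a\<bar> powr \<alpha>"
    using \<open>a \<noteq> 0\<close> by (intro tendsto_intros lim) auto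
  moreover have "eventually (\<lambda>n. \<sigma> * \<bar>f n / real n powr r\<bar> powr \<alpha>
      = rpow (f n) \<alpha> / real n powr (r * \<alpha>)) sequentially"
    using ev by eventually_elim (simp add: powr_divide powr_powr abs_divide)
  ultimately show ?thesis
    unfolding has_leading_term_def \<sigma> by (rule Lim_transform_eventually)
qed

section \<open>The family\<close>

text \<open>
  The two claims need each other: the limit law for quotients and the analysis of real powers
  only work for a nonzero leading coefficient.
\<close>
lemma in_family_leading_term:
  assumes "in_family E r c"
  shows "c \<noteq> 0 \<and> has_leading_term (expr_val E) r c"
  using assms
proof (induction rule: in_family.induct)
  case (const a)
  have "eventually (\<lambda>n. a = a / real n powr 0) sequentially"
    using eventually_gt_at_top[of "0::nat"] by eventually_elim simp
  then show ?case
    using const by (auto simp: has_leading_term_def intro: Lim_transform_eventually[OF tendsto_const])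
next
  case var
  have "eventually (\<lambda>n. 1 = real n / real n powr 1) sequentially"
    using eventually_gt_at_top[of "0::nat"] by eventually_elim simp
  then show ?case
    by (auto simp: has_leading_term_def intro: Lim_transform_eventually[OF tendsto_const])
next
  case (mult E1 r1 a1 E2 r2 a2)
  then show ?case using has_leading_term_mult by (simp add: fun_eq_iff)
next
  case (divide E1 r1 a1 E2 r2 a2)
  then show ?case using has_leading_term_divide by simp
next
  case (pow E1 r1 a1 \<alpha>)
  then have "eventually (\<lambda>n. rpow_defined (expr_val E1 n) \<alpha>) sequentially"
    by (auto simp: eventually_sequentially)
  with pow show ?case using has_leading_term_rpow rpow_nonzero by simp
next
  case (add_neq E1 r1 a1 E2 r2 a2)
  then show ?case using has_leading_term_add_neq[of "expr_val E1" r1 a1 "expr_val E2" r2 a2] by simp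
next
  case (sub_neq E1 r1 a1 E2 r2 a2)
  then show ?case
    using has_leading_term_add_neq[of "expr_val E1" r1 a1 "\<lambda>n. - expr_val E2 n" r2 "- a2"]
      has_leading_term_uminus by simp
next
  case (add_eq E1 r a1 E2 a2)
  then show ?case using has_leading_term_add by simp
next
  case (sub_eq E1 r a1 E2 a2)
  then show ?case using has_leading_term_diff by simp
qed

section \<open>Convergence of the series\<close>

text \<open>
  Dividing by \<open>c\<close> makes the sequence eventually positive, so that one comparison serves both signs.
\<close>
lemma has_leading_term_bounds:
  assumes "has_leading_term f r c" "c \<noteq> 0"
  shows "eventually (\<lambda>n. real n powr r / 2 \<le> f n / c \<and> f n / c \<le> 2 * real n powr r) sequentially"
proof -
  have "(\<lambda>n. f n / real n powr r / c) \<longlonglongrightarrow> c / c"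
    using assms by (intro tendsto_divide tendsto_const) (auto simp: has_leading_term_def)
  then have lim: "(\<lambda>n. f n / real n powr r / c) \<longlonglongrightarrow> 1" using \<open>c \<noteq> 0\<close> by simp
  have "eventually (\<lambda>n. f n / real n powr r / c > 1 / 2) sequentially"
    "eventually (\<lambda>n. f n / real n powr r / c < 2) sequentially"
    using order_tendstoD[OF lim, of "1/2"] order_tendstoD[OF lim, of 2] by simp_all
  then show ?thesis
    using eventually_gt_at_top[of "0::nat"]
  proof eventually_elim
    case (elim n)
    have "real n powr r > 0" using elim(3) by simp
    moreover have "f n / real n powr r / c = (f n / c) / real n powr r" by simp
    then have "1 / 2 < (f n / c) / real n powr r" "(f n / c) / real n powr r < 2"
      using elim(1,2) by (simp_all only:)
    ultimately have "1 / 2 * real n powr r < f n / c" "f n / c < 2 * real n powr r"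
      by (simp_all only: pos_less_divide_eq pos_divide_less_eq)
    then show ?case by linarith
  qed
qed

lemma has_leading_term_summable_abs:
  assumes "has_leading_term f r c" "c \<noteq> 0" "r < -1"
  shows "summable (\<lambda>n. \<bar>f n\<bar>)"
proof (rule summable_comparison_test_ev)
  show "summable (\<lambda>n. \<bar>c\<bar> * (2 * real n powr r))"
    using \<open>r < -1\<close> by (intro summable_mult) (simp add: summable_real_powr_iff)
  show "eventually (\<lambda>n. norm \<bar>f n\<bar> \<le> \<bar>c\<bar> * (2 * real n powr r)) sequentially"
    using has_leading_term_bounds[OF assms(1,2)]
  proof eventually_elim
    case (elim n)
    have "0 \<le> real n powr r" by simp
    with elim have "\<bar>f n / c\<bar> \<le> 2 * real n powr r" by linarith
    then show ?case using \<open>c \<noteq> 0\<close> by (simp add: abs_divide field_simps)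
  qed
qed

lemma has_leading_term_not_summable:
  assumes "has_leading_term f r c" "c \<noteq> 0" "r \<ge> -1"
  shows "\<not> summable f"
proof
  assume "summable f"
  then have "summable (\<lambda>n. 2 * (f n / c))" by (intro summable_mult summable_divide)
  moreover have "eventually (\<lambda>n. norm (real n powr r) \<le> 2 * (f n / c)) sequentially"
    using has_leading_term_bounds[OF assms(1,2)] by eventually_elim (simp add: mult.commute)
  ultimately have "summable (\<lambda>n. real n powr r)"
    by (rule summable_comparison_test_ev[rotated])
  then show False using \<open>r \<ge> -1\<close> by (simp add: summable_real_powr_iff)
qed

theorem mainTheorem1:
  fixes E :: expr and r c :: real and n\<^sub>E :: nat
  assumes "in_family E r c"
    and "\<forall>n\<ge>n\<^sub>E. defined_at E n"
    and "\<exists>n\<ge>n\<^sub>E. expr_val E n \<noteq> 0"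
  shows "(r < -1 \<longrightarrow> summable (\<lambda>k. \<bar>expr_val E (n\<^sub>E + k)\<bar>)) \<and>
         (r \<ge> -1 \<longrightarrow> \<not> summable (\<lambda>k. expr_val E (n\<^sub>E + k)))"
proof -
  have lead: "has_leading_term (expr_val E) r c" "c \<noteq> 0"
    using in_family_leading_term[OF assms(1)] by auto
  show ?thesis
    using has_leading_term_summable_abs[OF lead] has_leading_term_not_summable[OF lead]
      summable_iff_shift[of "\<lambda>n. \<bar>expr_val E n\<bar>" n\<^sub>E] summable_iff_shift[of "expr_val E" n\<^sub>E]
    by (simp add: add.commute)
qed

end
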